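(* Let $f\in V^*_+$ and let $u\in\mathbf Q(f)$ with $0\le u\le\bar u$ a.e. Assume (A1), (A3), (A4), (A5) (stated in the context, the last two for this $u$), and either (A2a), with $d\in V^*_+$ arbitrary as admissible directions, or (A2b) and $f\in L^\infty_+(\Omega)$, with $d\in L^\infty_+(\Omega)$ as admissible directions. For an admissible direction $d$ let $\alpha=\alpha(d)\in V_+$ be the directional derivative of the QVI solution map at $u$, i.e. there is $q(t)\in\mathbf Q(f+td)$ with $u\le q(t)\le\bar q(t)$ a.e., $q(t)=u+t\alpha+o(t)$ for all $t>0$ with $t^{-1}o(t)\to0$ in $V$ as $t\to0^+$, and $$\alpha\in\mathcal K^u(\alpha):\quad\langle A\alpha-d,\alpha-v\rangle\le0\quad\forall v\in\mathcal K^u(\alpha).$$ If strict complementarity holds, i.e. $\mathcal K^u(w)=\mathcal S^u(w)$ for all $w\in V$, then $\alpha$ satisfies $$\alpha\in\mathcal S^u(\alpha):\quad\langle A\alpha-d,\alpha-v\rangle=0\quad\forall v\in\mathcal S^u(\alpha).$$ In this case, if in addition $h\mapsto\Phi'(v)(h)$ is linear for each $v$, then $\alpha(c_1d_1+c_2d_2)=c_1\alpha(d_1)+c_2\alpha(d_2)$ for all positive constants $c_1,c_2$ and all admissible (non-negative) directions $d_1,d_2$.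
   Context: Setting: $X$ is a locally compact topological space that is countable at infinity, $\xi$ is a Radon measure on $X$, $H:=L^2(X;\xi)$ (real-valued), and $V$ is a real Hilbert space with $V\subset H$ continuously and densely such that $|u|\in V$ and $\|u^+\|_V\le\kappa\|u\|_V$ for all $u\in V$, for some constant $\kappa>0$ (convention $u=u^+-u^-$). $V\cap C_c(X)$ is dense in $C_c(X)$ in the supremum norm and dense in $V$ in the $V$-norm. $A\colon V\to V^*$ is linear and, for all $u,v\in V$, $\langle Au,v\rangle\le C_b\|u\|_V\|v\|_V$, $\langle Au,u\rangle\ge C_a\|u\|_V^2$ with $C_a>0$, and $\langle Au^+,u^-\rangle\le0$. The map $\Phi\colon H\to V$ (possibly nonlinear) satisfies $\Phi(0)\ge0$ a.e. and is increasing: $u\ge v$ a.e. implies $\Phi(u)\ge\Phi(v)$ a.e. Notation: $V_+:=\{v\in V:v\ge0\text{ a.e.}\}$, $V^*_+:=\{g\in V^*:\langle g,v\rangle\ge0\ \forall v\in V_+\}$; $L^\infty_+(\Omega)$ is the set of a.e. non-negative elements of $L^\infty(\Omega)$. $\mathbf K(\varphi):=\{v\in V:v\le\Phi(\varphi)\text{ a.e.}\}$. For $f\in V^*$, $\mathbf Q(f)$ is the set of all $u\in V$ with $u\in\mathbf K(u)$ and $\langle Au-f,u-v\rangle\le0$ for all $v\in\mathbf K(u)$. $\bar u,\bar q(t)\in V$ are the solutions of $A\bar u=f$ and $A\bar q(t)=f+td$. Elements of $V$ are represented by quasi-continuous representatives, and q.e. means outside a set of capacity zero, for the usual capacity associated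 with $V$: $\mathrm{cap}(E)=\inf\{\|v\|_V^2: v\in V,\ v\ge1\text{ a.e. on an open neighbourhood of }E\}$. $\mathcal A(u):=\{x\in X:u(x)=\Phi(u)(x)\}$. For $w\in V$, $\mathcal K^u(w):=\{\varphi\in V:\varphi\le\Phi'(u)(w)\text{ q.e. on }\mathcal A(u)\text{ and }\langle Au-f,\varphi-\Phi'(u)(w)\rangle=0\}$ and $\mathcal S^u(w):=\{\varphi\in V:\varphi=\Phi'(u)(w)\text{ q.e. on }\mathcal A(u)\}$. $B_R(z)$ is the closed ball of radius $R$ around $z$ in $V$. Completely continuous means mapping weakly convergent sequences to strongly convergent ones. Assumptions: (A1) $\Phi\colon V\to V$ is Hadamard directionally differentiable: for all $v,h\in V$ the limit $\Phi'(v)(h):=\lim_{h'\to h,\,t\to0^+}(\Phi(v+th')-\Phi(v))/t$ exists in $V$. (A2a) $\Phi\colon V\to V$ is completely continuous. (A2b) $V=H^1(\Omega)$, $X=\overline\Omega$ with $\Omega$ a bounded Lipschitz domain, $\Phi\colon V\cap L^\infty_+(\Omega)\to L^\infty_+(\Omega)$ is concave, and $\Phi(0)\ge c>0$ for a constant $c$. (A3) For fixed $v\in V$, $\Phi'(v)\colon V\to V$ is completely continuous. (A4) For any $b\in V$, $h\colon(0,T)\to V$ and $\lambda\in[0,1]$: $\|\Phi'(u+tb+\lambda h(t))h(t)\|_V/t\to0$ as $t\to0^+$ whenever $h(t)/t\to0$ as $t\to0^+$. (A5) There are $\epsilon>0$ and a constant $C_\Phi<\frac1{1+C_a^{-1}C_b}$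 with $\|\Phi'(z)(v)\|_V\le C_\Phi\|v\|_V$ for all $z\in B_\epsilon(u)$ and all $v\in V$. *)

theory Defs
  imports "HOL-Analysis.Analysis"
begin

section \<open>Radon measures, L2 and L-infinity\<close>

definition borel_algebra :: "'x topology \<Rightarrow> 'x measure" where
  "borel_algebra X = sigma (topspace X) {U. openin X U}"

definition sigma_compact_space :: "'x topology \<Rightarrow> bool" where
  "sigma_compact_space X \<longleftrightarrow>
     (\<exists>K :: nat \<Rightarrow> 'x set. (\<forall>n. compactin X (K n)) \<and> topspace X = (\<Union>n. K n))"

definition radon_measure :: "'x topology \<Rightarrow> 'x measure \<Rightarrow> bool" where
  "radon_measure X \<xi> \<longleftrightarrow>
     space \<xi> = topspace X \<and> sets \<xi> = sets (borel_algebra X) \<and>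
     (\<forall>K. compactin X K \<longrightarrow> emeasure \<xi> K < \<infinity>) \<and>
     (\<forall>B\<in>sets \<xi>. emeasure \<xi> B = (INF U\<in>{U. openin X U \<and> B \<subseteq> U}. emeasure \<xi> U)) \<and>
     (\<forall>U. openin X U \<longrightarrow> emeasure \<xi> U = (SUP K\<in>{K. compactin X K \<and> K \<subseteq> U}. emeasure \<xi> K))"

text \<open>The elements of the following spaces are functions; they are compared almost everywhere.\<close>

definition L2 :: "'x measure \<Rightarrow> ('x \<Rightarrow> real) set" where
  "L2 \<xi> = {g \<in> borel_measurable \<xi>. integrable \<xi> (\<lambda>x. (g x)\<^sup>2)}"

definition L2_norm :: "'x measure \<Rightarrow> ('x \<Rightarrow> real) \<Rightarrow> real" where
  "L2_norm \<xi> g = sqrt (\<integral>x. (g x)\<^sup>2 \<partial>\<xi>)"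

definition Linf_plus :: "'x measure \<Rightarrow> ('x \<Rightarrow> real) set" where
  "Linf_plus \<xi> = {g \<in> borel_measurable \<xi>. (\<exists>C. AE x in \<xi>. g x \<le> C) \<and> (AE x in \<xi>. 0 \<le> g x)}"

definition Cc :: "'x topology \<Rightarrow> ('x \<Rightarrow> real) set" where
  "Cc X = {g. continuous_map X euclideanreal g \<and>
              (\<exists>K. compactin X K \<and> (\<forall>x\<in>topspace X - K. g x = 0))}"


section \<open>The spaces V and H, the operator A and the obstacle map\<close>

text \<open>The Hilbert space V is the type \<open>'v\<close>; its inclusion into H = L2(X;\<open>\<xi>\<close>) is given by a map
  \<open>emb\<close> that sends each element of V to a function representing it. The choice of the
  representative is immaterial in everything that is stated almost everywhere.
  The dual of V is the type of bounded linear functionals on \<open>'v\<close>.\<close>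

locale function_hilbert_space =
  fixes X :: "'x topology" and \<xi> :: "'x measure"
    and emb :: "'v::{real_inner, complete_space} \<Rightarrow> 'x \<Rightarrow> real"
  assumes Hausdorff: "Hausdorff_space X"
    and locally_compact: "locally_compact_space X"
    and sigma_compact: "sigma_compact_space X"
    and radon: "radon_measure X \<xi>"
    and emb_L2: "emb v \<in> L2 \<xi>"
    and emb_linear: "AE x in \<xi>. emb (a *\<^sub>R v + b *\<^sub>R w) x = a * emb v x + b * emb w x"
    and emb_inject: "(AE x in \<xi>. emb v x = emb w x) \<Longrightarrow> v = w"
    and emb_continuous: "\<exists>C. \<forall>v. L2_norm \<xi> (emb v) \<le> C * norm v"
    and emb_dense: "g \<in> L2 \<xi> \<Longrightarrow> e > 0 \<Longrightarrow> \<exists>v. L2_norm \<xi> (\<lambda>x. g x - emb v x) < e"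
    and abs_closed: "\<exists>w. AE x in \<xi>. emb w x = \<bar>emb v x\<bar>"
    and pos_part_bound:
      "\<exists>\<kappa>>0. \<forall>v p. (AE x in \<xi>. emb p x = max (emb v x) 0) \<longrightarrow> norm p \<le> \<kappa> * norm v"
    and dense_in_Cc: "g \<in> Cc X \<Longrightarrow> e > 0 \<Longrightarrow>
      \<exists>h\<in>Cc X. (\<exists>v. AE x in \<xi>. emb v x = h x) \<and> (\<forall>x\<in>topspace X. \<bar>g x - h x\<bar> < e)"
    and Cc_dense: "e > 0 \<Longrightarrow>
      \<exists>w. (\<exists>h\<in>Cc X. AE x in \<xi>. emb w x = h x) \<and> norm (v - w) < e"

text \<open>The obstacle map acts on functions in H; that it respects almost everywhere equality follows
  from \<open>Phi_increasing\<close> and \<open>emb_inject\<close>.\<close>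

locale obstacle_setting = function_hilbert_space X \<xi> emb
  for X :: "'x topology" and \<xi> :: "'x measure"
    and emb :: "'v::{real_inner, complete_space} \<Rightarrow> 'x \<Rightarrow> real" +
  fixes A :: "'v \<Rightarrow> ('v \<Rightarrow>\<^sub>L real)" and Ca Cb :: real
    and \<Phi> :: "('x \<Rightarrow> real) \<Rightarrow> 'v"
  assumes A_linear: "linear A"
    and A_bounded: "A v w \<le> Cb * norm v * norm w"
    and Ca_pos: "Ca > 0"
    and A_coercive: "A v v \<ge> Ca * (norm v)\<^sup>2"
    and A_T_monotone: "(AE x in \<xi>. emb p x = max (emb v x) 0) \<Longrightarrow>
      (AE x in \<xi>. emb n x = max (- emb v x) 0) \<Longrightarrow> A p n \<le> 0"
    and Phi_0: "AE x in \<xi>. emb (\<Phi> (\<lambda>x. 0)) x \<ge> 0"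
    and Phi_increasing: "g \<in> L2 \<xi> \<Longrightarrow> h \<in> L2 \<xi> \<Longrightarrow> (AE x in \<xi>. h x \<le> g x) \<Longrightarrow>
      (AE x in \<xi>. emb (\<Phi> h) x \<le> emb (\<Phi> g) x)"

definition V_plus :: "'x measure \<Rightarrow> ('v \<Rightarrow> 'x \<Rightarrow> real) \<Rightarrow> 'v set" where
  "V_plus \<xi> emb = {v. AE x in \<xi>. 0 \<le> emb v x}"

definition dual_plus ::
  "'x measure \<Rightarrow> ('v::real_normed_vector \<Rightarrow> 'x \<Rightarrow> real) \<Rightarrow> ('v \<Rightarrow>\<^sub>L real) set" where
  "dual_plus \<xi> emb = {g. \<forall>v\<in>V_plus \<xi> emb. blinfun_apply g v \<ge> 0}"

text \<open>\<open>Linf_plus\<close> viewed as a subset of the dual of V, through integration against \<open>\<xi>\<close>.\<close>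

definition Linf_dual_plus ::
  "'x measure \<Rightarrow> ('v::real_normed_vector \<Rightarrow> 'x \<Rightarrow> real) \<Rightarrow> ('v \<Rightarrow>\<^sub>L real) set" where
  "Linf_dual_plus \<xi> emb = {d. \<exists>g\<in>Linf_plus \<xi>.
     \<forall>v. integrable \<xi> (\<lambda>x. g x * emb v x) \<and>
         blinfun_apply d v = (\<integral>x. g x * emb v x \<partial>\<xi>)}"


section \<open>The quasi-variational inequality\<close>

definition K_set ::
  "'x measure \<Rightarrow> ('v \<Rightarrow> 'x \<Rightarrow> real) \<Rightarrow> (('x \<Rightarrow> real) \<Rightarrow> 'v) \<Rightarrow> ('x \<Rightarrow> real) \<Rightarrow> 'v set" where
  "K_set \<xi> emb \<Phi> \<phi> = {v. AE x in \<xi>. emb v x \<le> emb (\<Phi> \<phi>) x}"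

definition Q_set ::
  "'x measure \<Rightarrow> ('v::real_normed_vector \<Rightarrow> 'x \<Rightarrow> real) \<Rightarrow> ('v \<Rightarrow> ('v \<Rightarrow>\<^sub>L real)) \<Rightarrow>
   (('x \<Rightarrow> real) \<Rightarrow> 'v) \<Rightarrow> ('v \<Rightarrow>\<^sub>L real) \<Rightarrow> 'v set" where
  "Q_set \<xi> emb A \<Phi> f = {u. u \<in> K_set \<xi> emb \<Phi> (emb u) \<and>
     (\<forall>v\<in>K_set \<xi> emb \<Phi> (emb u). (A u - f) (u - v) \<le> 0)}"


section \<open>Capacity and quasi-continuous representatives\<close>

text \<open>The capacity takes the value \<open>\<infinity>\<close> if there is no admissible function.\<close>

definition cap ::
  "'x topology \<Rightarrow> 'x measure \<Rightarrow> ('v::real_normed_vector \<Rightarrow> 'x \<Rightarrow> real) \<Rightarrow> 'x set \<Rightarrow> ennreal" where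
  "cap X \<xi> emb E =
     (INF v\<in>{v. \<exists>U. openin X U \<and> E \<subseteq> U \<and> (AE x in \<xi>. x \<in> U \<longrightarrow> emb v x \<ge> 1)}.
        ennreal ((norm v)\<^sup>2))"

definition qe_on ::
  "'x topology \<Rightarrow> 'x measure \<Rightarrow> ('v::real_normed_vector \<Rightarrow> 'x \<Rightarrow> real) \<Rightarrow> 'x set \<Rightarrow>
   ('x \<Rightarrow> bool) \<Rightarrow> bool" where
  "qe_on X \<xi> emb E P \<longleftrightarrow> cap X \<xi> emb {x \<in> E. \<not> P x} = 0"

definition quasi_continuous ::
  "'x topology \<Rightarrow> 'x measure \<Rightarrow> ('v::real_normed_vector \<Rightarrow> 'x \<Rightarrow> real) \<Rightarrow>
   ('x \<Rightarrow> real) \<Rightarrow> bool" where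
  "quasi_continuous X \<xi> emb g \<longleftrightarrow>
     (\<forall>e>0. \<exists>G. openin X G \<and> cap X \<xi> emb G < ennreal e \<and>
        continuous_map (subtopology X (topspace X - G)) euclideanreal g)"

text \<open>A quasi-continuous representative exists and is unique up to a set of capacity zero, so the
  choice made here affects none of the notions that are stated quasi-everywhere below.\<close>

definition qc_rep ::
  "'x topology \<Rightarrow> 'x measure \<Rightarrow> ('v::real_normed_vector \<Rightarrow> 'x \<Rightarrow> real) \<Rightarrow> 'v \<Rightarrow> 'x \<Rightarrow> real" where
  "qc_rep X \<xi> emb v =
     (SOME g. quasi_continuous X \<xi> emb g \<and> (AE x in \<xi>. g x = emb v x))"


section \<open>Derivatives and complete continuity\<close>

definition hadamard_quotient_limit ::
  "('v::real_normed_vector \<Rightarrow> 'v) \<Rightarrow> 'v \<Rightarrow> 'v \<Rightarrow> 'v \<Rightarrow> bool" where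
  "hadamard_quotient_limit F v h l \<longleftrightarrow>
     ((\<lambda>(h', t). (F (v + t *\<^sub>R h') - F v) /\<^sub>R t) \<longlongrightarrow> l) (nhds h \<times>\<^sub>F at_right (0::real))"

definition hadamard_differentiable :: "('v::real_normed_vector \<Rightarrow> 'v) \<Rightarrow> bool" where
  "hadamard_differentiable F \<longleftrightarrow> (\<forall>v h. \<exists>l. hadamard_quotient_limit F v h l)"

definition hadamard_deriv :: "('v::real_normed_vector \<Rightarrow> 'v) \<Rightarrow> 'v \<Rightarrow> 'v \<Rightarrow> 'v" where
  "hadamard_deriv F v h = (THE l. hadamard_quotient_limit F v h l)"

definition weakly_converges :: "(nat \<Rightarrow> 'v::real_normed_vector) \<Rightarrow> 'v \<Rightarrow> bool" where
  "weakly_converges x l \<longleftrightarrow> (\<forall>g :: 'v \<Rightarrow>\<^sub>L real. (\<lambda>n. blinfun_apply g (x n)) \<longlonglongrightarrow> blinfun_apply g l)"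

definition completely_continuous :: "('v::real_normed_vector \<Rightarrow> 'v) \<Rightarrow> bool" where
  "completely_continuous F \<longleftrightarrow>
     (\<forall>x l. weakly_converges x l \<longrightarrow> (\<lambda>n. F (x n)) \<longlonglongrightarrow> F l)"


section \<open>The linearised problem\<close>

text \<open>From here on \<open>F\<close> is the obstacle map regarded as a map from V to V.\<close>

definition coincidence_set ::
  "'x topology \<Rightarrow> 'x measure \<Rightarrow> ('v::real_normed_vector \<Rightarrow> 'x \<Rightarrow> real) \<Rightarrow> ('v \<Rightarrow> 'v) \<Rightarrow>
   'v \<Rightarrow> 'x set" where
  "coincidence_set X \<xi> emb F u =
     {x \<in> topspace X. qc_rep X \<xi> emb u x = qc_rep X \<xi> emb (F u) x}"

definition crit_set ::
  "'x topology \<Rightarrow> 'x measure \<Rightarrow> ('v::real_normed_vector \<Rightarrow> 'x \<Rightarrow> real) \<Rightarrow>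
   ('v \<Rightarrow> ('v \<Rightarrow>\<^sub>L real)) \<Rightarrow> ('v \<Rightarrow> 'v) \<Rightarrow> ('v \<Rightarrow>\<^sub>L real) \<Rightarrow> 'v \<Rightarrow> 'v \<Rightarrow> 'v set" where
  "crit_set X \<xi> emb A F f u w = {\<phi>.
     qe_on X \<xi> emb (coincidence_set X \<xi> emb F u)
       (\<lambda>x. qc_rep X \<xi> emb \<phi> x \<le> qc_rep X \<xi> emb (hadamard_deriv F u w) x) \<and>
     (A u - f) (\<phi> - hadamard_deriv F u w) = 0}"

definition S_set ::
  "'x topology \<Rightarrow> 'x measure \<Rightarrow> ('v::real_normed_vector \<Rightarrow> 'x \<Rightarrow> real) \<Rightarrow>
   ('v \<Rightarrow> 'v) \<Rightarrow> 'v \<Rightarrow> 'v \<Rightarrow> 'v set" where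
  "S_set X \<xi> emb F u w = {\<phi>.
     qe_on X \<xi> emb (coincidence_set X \<xi> emb F u)
       (\<lambda>x. qc_rep X \<xi> emb \<phi> x = qc_rep X \<xi> emb (hadamard_deriv F u w) x)}"

definition qvi_dir_derivative ::
  "'x topology \<Rightarrow> 'x measure \<Rightarrow> ('v::real_normed_vector \<Rightarrow> 'x \<Rightarrow> real) \<Rightarrow>
   ('v \<Rightarrow> ('v \<Rightarrow>\<^sub>L real)) \<Rightarrow> (('x \<Rightarrow> real) \<Rightarrow> 'v) \<Rightarrow> ('v \<Rightarrow>\<^sub>L real) \<Rightarrow> 'v \<Rightarrow>
   ('v \<Rightarrow>\<^sub>L real) \<Rightarrow> 'v \<Rightarrow> bool" where
  "qvi_dir_derivative X \<xi> emb A \<Phi> f u d \<alpha> \<longleftrightarrow>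
     \<alpha> \<in> V_plus \<xi> emb \<and>
     (\<exists>q qbar :: real \<Rightarrow> 'v.
        (\<forall>t>0. A (qbar t) = f + t *\<^sub>R d \<and> q t \<in> Q_set \<xi> emb A \<Phi> (f + t *\<^sub>R d) \<and>
           (AE x in \<xi>. emb u x \<le> emb (q t) x) \<and> (AE x in \<xi>. emb (q t) x \<le> emb (qbar t) x)) \<and>
        ((\<lambda>t. (q t - u - t *\<^sub>R \<alpha>) /\<^sub>R t) \<longlongrightarrow> 0) (at_right 0)) \<and>
     \<alpha> \<in> crit_set X \<xi> emb A (\<lambda>v. \<Phi> (emb v)) f u \<alpha> \<and>
     (\<forall>v\<in>crit_set X \<xi> emb A (\<lambda>v. \<Phi> (emb v)) f u \<alpha>. (A \<alpha> - d) (\<alpha> - v) \<le> 0)"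


section \<open>Bounded Lipschitz domains and the Sobolev space H1\<close>

text \<open>Near each boundary point the domain is, in suitable Cartesian coordinates with vertical
  direction \<open>e\<close>, the region above the graph of a Lipschitz function \<open>\<gamma>\<close> on the orthogonal
  complement of \<open>e\<close>.\<close>

definition bounded_lipschitz_domain :: "'n::euclidean_space set \<Rightarrow> bool" where
  "bounded_lipschitz_domain \<Omega> \<longleftrightarrow>
     open \<Omega> \<and> connected \<Omega> \<and> bounded \<Omega> \<and> \<Omega> \<noteq> {} \<and>
     (\<forall>p\<in>frontier \<Omega>. \<exists>U e \<gamma> L. open U \<and> p \<in> U \<and> norm e = 1 \<and>
        L-lipschitz_on {y. y \<bullet> e = 0} (\<gamma> :: 'n \<Rightarrow> real) \<and>
        \<Omega> \<inter> U = {y \<in> U. \<gamma> (y - (y \<bullet> e) *\<^sub>R e) < y \<bullet> e})"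

primrec C_k :: "nat \<Rightarrow> ('n::euclidean_space \<Rightarrow> real) \<Rightarrow> bool" where
  "C_k 0 \<phi> \<longleftrightarrow> continuous_on UNIV \<phi>"
| "C_k (Suc k) \<phi> \<longleftrightarrow> (\<forall>x. \<phi> differentiable (at x)) \<and>
     (\<forall>i\<in>Basis. C_k k (\<lambda>x. frechet_derivative \<phi> (at x) i))"

definition test_functions :: "'n::euclidean_space set \<Rightarrow> ('n \<Rightarrow> real) set" where
  "test_functions \<Omega> =
     {\<phi>. (\<forall>k. C_k k \<phi>) \<and> (\<exists>K. compact K \<and> K \<subseteq> \<Omega> \<and> (\<forall>x. x \<notin> K \<longrightarrow> \<phi> x = 0))}"

text \<open>\<open>has_weak_gradient \<Omega> h g\<close>: the function \<open>h\<close> is in H1(\<open>\<Omega>\<close>) with weak gradient \<open>g\<close>.\<close>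

definition has_weak_gradient ::
  "'n::euclidean_space set \<Rightarrow> ('n \<Rightarrow> real) \<Rightarrow> ('n \<Rightarrow> 'n) \<Rightarrow> bool" where
  "has_weak_gradient \<Omega> h g \<longleftrightarrow>
     h \<in> L2 (lebesgue_on \<Omega>) \<and>
     (\<forall>i\<in>Basis. (\<lambda>x. g x \<bullet> i) \<in> L2 (lebesgue_on \<Omega>) \<and>
        (\<forall>\<phi>\<in>test_functions \<Omega>.
           (\<integral>x. h x * frechet_derivative \<phi> (at x) i \<partial>lebesgue_on \<Omega>) =
           - (\<integral>x. (g x \<bullet> i) * \<phi> x \<partial>lebesgue_on \<Omega>)))"

definition H1_norm :: "'n::euclidean_space set \<Rightarrow> ('n \<Rightarrow> real) \<Rightarrow> ('n \<Rightarrow> 'n) \<Rightarrow> real" where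
  "H1_norm \<Omega> h g = sqrt ((\<integral>x. (h x)\<^sup>2 \<partial>lebesgue_on \<Omega>) + (\<integral>x. (norm (g x))\<^sup>2 \<partial>lebesgue_on \<Omega>))"

text \<open>V = H1(\<open>\<Omega>\<close>), X is the closure of \<open>\<Omega>\<close> and \<open>\<xi>\<close> is the Lebesgue measure. As the points of X
  have a type \<open>'x\<close> of their own, the identification of the closure of \<open>\<Omega>\<close> with X is made explicit
  by a homeomorphism \<open>\<iota>\<close>; for \<open>'x\<close> equal to \<open>'n\<close> it may be taken to be the identity.\<close>

definition is_H1 ::
  "'n::euclidean_space set \<Rightarrow> ('n \<Rightarrow> 'x) \<Rightarrow> 'x topology \<Rightarrow> 'x measure \<Rightarrow>
   ('v::real_normed_vector \<Rightarrow> 'x \<Rightarrow> real) \<Rightarrow> bool" where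
  "is_H1 \<Omega> \<iota> X \<xi> emb \<longleftrightarrow>
     homeomorphic_map (top_of_set (closure \<Omega>)) X \<iota> \<and>
     \<xi> = distr (restrict_space lborel (closure \<Omega>)) (borel_algebra X) \<iota> \<and>
     (\<forall>v. \<exists>g. has_weak_gradient \<Omega> (\<lambda>x. emb v (\<iota> x)) g \<and>
        norm v = H1_norm \<Omega> (\<lambda>x. emb v (\<iota> x)) g) \<and>
     (\<forall>h g. has_weak_gradient \<Omega> h g \<longrightarrow>
        (\<exists>v. AE x in lebesgue_on \<Omega>. emb v (\<iota> x) = h x))"


section \<open>The assumptions on the obstacle map\<close>

definition assumption_A2b ::
  "'n::euclidean_space set \<Rightarrow> ('n \<Rightarrow> 'x) \<Rightarrow> 'x topology \<Rightarrow> 'x measure \<Rightarrow>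
   ('v::real_normed_vector \<Rightarrow> 'x \<Rightarrow> real) \<Rightarrow> (('x \<Rightarrow> real) \<Rightarrow> 'v) \<Rightarrow> bool" where
  "assumption_A2b \<Omega> \<iota> X \<xi> emb \<Phi> \<longleftrightarrow>
     bounded_lipschitz_domain \<Omega> \<and> is_H1 \<Omega> \<iota> X \<xi> emb \<and>
     (\<forall>v. emb v \<in> Linf_plus \<xi> \<longrightarrow> emb (\<Phi> (emb v)) \<in> Linf_plus \<xi>) \<and>
     (\<forall>v w. \<forall>s\<in>{0..1}. emb v \<in> Linf_plus \<xi> \<and> emb w \<in> Linf_plus \<xi> \<longrightarrow>
        (AE x in \<xi>. s * emb (\<Phi> (emb v)) x + (1 - s) * emb (\<Phi> (emb w)) x
                   \<le> emb (\<Phi> (emb (s *\<^sub>R v + (1 - s) *\<^sub>R w))) x)) \<and>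
     (\<exists>c>0. AE x in \<xi>. c \<le> emb (\<Phi> (\<lambda>x. 0)) x)"

text \<open>Only the behaviour of \<open>h\<close> near 0 matters, so \<open>h\<close> need not be restricted to an interval (0,T).\<close>

definition assumption_A4 :: "('v::real_normed_vector \<Rightarrow> 'v) \<Rightarrow> 'v \<Rightarrow> bool" where
  "assumption_A4 F u \<longleftrightarrow>
     (\<forall>b (h :: real \<Rightarrow> 'v). \<forall>s\<in>{0..1}. ((\<lambda>t. h t /\<^sub>R t) \<longlongrightarrow> 0) (at_right 0) \<longrightarrow>
        ((\<lambda>t. norm (hadamard_deriv F (u + t *\<^sub>R b + s *\<^sub>R h t) (h t)) / t) \<longlongrightarrow> 0) (at_right 0))"

definition assumption_A5 ::
  "('v::real_normed_vector \<Rightarrow> 'v) \<Rightarrow> real \<Rightarrow> real \<Rightarrow> 'v \<Rightarrow> bool" where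
  "assumption_A5 F Ca Cb u \<longleftrightarrow>
     (\<exists>e>0. \<exists>C. C < 1 / (1 + inverse Ca * Cb) \<and>
        (\<forall>z\<in>cball u e. \<forall>v. norm (hadamard_deriv F z v) \<le> C * norm v))"

end

theory Submission
  imports Defs
begin

text \<open>Every element of V has a quasi-continuous representative, unique up to capacity zero, so
  evaluation is linear quasi-everywhere and \<open>S_set\<close> at \<open>w\<close> is the derivative at \<open>w\<close> plus a
  subspace \<open>S0\<close>. The reflection of \<open>v\<close> at \<open>\<alpha>\<close> therefore stays admissible and turns the
  inequality into an equality. If the derivative \<open>G\<close> is linear, then the defect
  \<open>\<beta> = \<alpha> - (c1 \<alpha>1 + c2 \<alpha>2)\<close> satisfies \<open>\<beta> - G \<beta> \<in> S0\<close> and \<open>A \<beta>\<close> annihilates \<open>S0\<close>, so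
  \<open>A \<beta> \<beta> = A \<beta> (G \<beta>)\<close>; coercivity and the smallness of \<open>G\<close> force \<open>\<beta> = 0\<close>.\<close>

section \<open>Dominated series in a complete normed space\<close>

text \<open>Increments of the partial sums of \<open>a\<close> are dominated by those of
  \<open>b\<close>, so the Cauchy property carries over. The norm bound on the sum is what the
  capacity estimates use. The sort is that of V, for which \<open>banach\<close> is not
  declared.\<close>

lemma sums_if_norm_le_summable:
  fixes a :: "nat \<Rightarrow> 'v::{real_normed_vector, complete_space}"
  assumes b: "summable b" and ab: "\<And>n. norm (a n) \<le> b n"
  obtains s where "a sums s" "norm s \<le> suminf b"
proof -
  define S where "S = (\<lambda>n. \<Sum>i<n. a i)"
  define T where "T = (\<lambda>n. \<Sum>i<n. b i)"
  have le: "dist (S m) (S n) \<le> dist (T m) (T n)" if "m \<le> n" for m n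
  proof -
    have split: "{..<n} = {..<m} \<union> {m..<n}" "{..<m} \<inter> {m..<n} = {}" using that by auto
    have "S n - S m = (\<Sum>i=m..<n. a i)" "T n - T m = (\<Sum>i=m..<n. b i)"
      unfolding S_def T_def split(1) by (simp_all add: sum.union_disjoint split(2))
    moreover have "norm (\<Sum>i=m..<n. a i) \<le> (\<Sum>i=m..<n. b i)"
      using ab by (simp add: sum_norm_le)
    ultimately show ?thesis
      by (smt (verit) dist_commute dist_norm real_norm_def)
  qed
  have le': "dist (S m) (S n) \<le> dist (T m) (T n)" for m n
    using le[of m n] le[of n m] by (metis dist_commute nat_le_linear)
  have "Cauchy T"
    using b unfolding T_def summable_iff_convergent by (rule convergent_Cauchy)
  then have "Cauchy S"
    unfolding Cauchy_def using le' by (meson le_less_trans)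
  then obtain s where s: "S \<longlonglongrightarrow> s"
    using Cauchy_convergent convergent_def by blast
  have "norm (S n) \<le> suminf b" for n
  proof -
    have "norm (S n) \<le> T n"
      unfolding S_def T_def using ab by (simp add: sum_norm_le)
    also have "\<dots> \<le> suminf b"
      unfolding T_def using b ab by (intro sum_le_suminf) (auto intro: order_trans[OF norm_ge_zero])
    finally show ?thesis .
  qed
  then have "norm s \<le> suminf b"
    using tendsto_norm[OF s] by (intro Lim_bounded[where M=0]) auto
  moreover have "a sums s" using s by (simp add: sums_def S_def)
  ultimately show ?thesis using that by blast
qed

context function_hilbert_space
begin

section \<open>Almost everywhere calculus for the embedding\<close>

lemma emb_add: "AE x in \<xi>. emb (v + w) x = emb v x + emb w x"
  using emb_linear[of 1 v 1 w] by simp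

lemma emb_diff: "AE x in \<xi>. emb (v - w) x = emb v x - emb w x"
  using emb_linear[of 1 v "-1" w] by simp

lemma emb_scaleR: "AE x in \<xi>. emb (a *\<^sub>R v) x = a * emb v x"
  using emb_linear[of a v 0 v] by simp

lemma emb_sum: "AE x in \<xi>. emb (\<Sum>i<n. v i) x = (\<Sum>i<n::nat. emb (v i) x)"
proof (induction n)
  case 0
  show ?case using emb_scaleR[of 0 0] by simp
next
  case (Suc n)
  show ?case using Suc.IH emb_add[of "\<Sum>i<n. v i" "v n"] by eventually_elim simp
qed

lemma emb_measurable [measurable]: "emb v \<in> borel_measurable \<xi>"
  using emb_L2[of v] by (simp add: L2_def)

lemma emb_square_integrable: "integrable \<xi> (\<lambda>x. (emb v x)\<^sup>2)"
  using emb_L2[of v] by (simp add: L2_def)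

text \<open>Continuity of V in L2 turns norm convergence into L1 convergence of the squared
  differences, and L1 convergence gives almost everywhere convergence along a subsequence.\<close>

lemma emb_AE_subseq:
  assumes "w \<longlonglongrightarrow> v"
  obtains r :: "nat \<Rightarrow> nat" where "strict_mono r" "AE x in \<xi>. (\<lambda>n. emb (w (r n)) x) \<longlonglongrightarrow> emb v x"
proof -
  obtain C where C: "\<And>v. L2_norm \<xi> (emb v) \<le> C * norm v"
    using emb_continuous by blast
  have "(\<lambda>n. norm (w n - v)) \<longlonglongrightarrow> 0"
    using assms by (simp add: LIM_zero tendsto_norm_zero)
  then have "(\<lambda>n. C * norm (w n - v)) \<longlonglongrightarrow> 0"
    using tendsto_mult_right_zero by blast
  then have "(\<lambda>n. L2_norm \<xi> (emb (w n - v))) \<longlonglongrightarrow> 0"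
    by (rule Lim_null_comparison[rotated]) (use C in \<open>simp add: L2_norm_def\<close>)
  then have "(\<lambda>n. (L2_norm \<xi> (emb (w n - v)))\<^sup>2) \<longlonglongrightarrow> 0"
    using tendsto_power[of _ 0 _ 2] by fastforce
  then have "(\<lambda>n. \<integral>x. norm ((emb (w n - v) x)\<^sup>2) \<partial>\<xi>) \<longlonglongrightarrow> 0"
    by (simp add: L2_norm_def)
  then obtain r :: "nat \<Rightarrow> nat" where r: "strict_mono r"
    and lim: "AE x in \<xi>. (\<lambda>n. (emb (w (r n) - v) x)\<^sup>2) \<longlonglongrightarrow> 0"
    using tendsto_L1_AE_subseq[of \<xi> "\<lambda>n x. (emb (w n - v) x)\<^sup>2"] emb_square_integrable by blast
  have "AE x in \<xi>. \<forall>n. emb (w (r n) - v) x = emb (w (r n)) x - emb v x"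
    unfolding AE_all_countable using emb_diff by blast
  with lim have "AE x in \<xi>. (\<lambda>n. emb (w (r n)) x) \<longlonglongrightarrow> emb v x"
  proof eventually_elim
    case (elim x)
    then have "(\<lambda>n. \<bar>emb (w (r n)) x - emb v x\<bar>) \<longlonglongrightarrow> 0"
      using tendsto_real_sqrt[OF elim(1)] by simp
    then show ?case
      by (simp add: LIM_zero_iff tendsto_rabs_zero_iff)
  qed
  with r that show ?thesis by blast
qed

text \<open>The modulus is the sum of the positive parts of \<open>d\<close> and \<open>- d\<close>,
  each bounded by \<kappa> times the norm of \<open>d\<close>; hence \<open>2 * \<kappa>\<close>
  works.\<close>

lemma emb_abs_bound:
  obtains \<mu> where "\<mu> > 0" "\<And>d a. (AE x in \<xi>. emb a x = \<bar>emb d x\<bar>) \<Longrightarrow> norm a \<le> \<mu> * norm d"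
proof -
  obtain \<kappa> where \<kappa>: "\<kappa> > 0"
    and bound: "\<And>v p. (AE x in \<xi>. emb p x = max (emb v x) 0) \<Longrightarrow> norm p \<le> \<kappa> * norm v"
    using pos_part_bound by blast
  have "norm a \<le> 2 * \<kappa> * norm d" if a: "AE x in \<xi>. emb a x = \<bar>emb d x\<bar>" for a d
  proof -
    let ?p = "(1/2) *\<^sub>R a + (1/2) *\<^sub>R d" and ?n = "(1/2) *\<^sub>R a + (-1/2) *\<^sub>R d"
    have "AE x in \<xi>. emb ?p x = max (emb d x) 0"
      using a emb_linear[of "1/2" a "1/2" d] by eventually_elim simp
    then have p: "norm ?p \<le> \<kappa> * norm d" by (rule bound)
    have "AE x in \<xi>. emb ?n x = max (emb (- d) x) 0"
      using a emb_linear[of "1/2" a "-1/2" d] emb_scaleR[of "-1" d] by eventually_elim simp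
    then have n: "norm ?n \<le> \<kappa> * norm (- d)" by (rule bound)
    have "a = ?p + ?n" by (simp flip: scaleR_add_left)
    then have "norm a \<le> norm ?p + norm ?n" by (metis norm_triangle_ineq)
    with p n show ?thesis by simp
  qed
  with \<kappa> that[of "2 * \<kappa>"] show ?thesis by simp
qed

section \<open>Capacity through test elements\<close>

text \<open>This is the admissibility condition in the infimum defining \<open>cap\<close>. Arguing
  with witnesses and their unsquared norms keeps \<open>ennreal\<close> arithmetic out of the
  estimates and lets the triangle inequality act directly.\<close>

definition cap_test :: "'v \<Rightarrow> 'x set \<Rightarrow> bool" where
  "cap_test v E \<longleftrightarrow> (\<exists>U. openin X U \<and> E \<subseteq> U \<and> (AE x in \<xi>. x \<in> U \<longrightarrow> 1 \<le> emb v x))"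

lemma cap_less_iff:
  assumes "r > 0"
  shows "cap X \<xi> emb E < ennreal (r\<^sup>2) \<longleftrightarrow> (\<exists>v. cap_test v E \<and> norm v < r)"
proof -
  have "cap X \<xi> emb E = (INF v\<in>{v. cap_test v E}. ennreal ((norm v)\<^sup>2))"
    by (simp add: cap_def cap_test_def)
  moreover have "ennreal ((norm v)\<^sup>2) < ennreal (r\<^sup>2) \<longleftrightarrow> norm v < r" for v :: 'v
    using assms using power_mono[of "r" "norm v" 2] power_strict_mono[of "norm v" r 2]
      assms by (auto simp: ennreal_less_iff not_le[symmetric])
  ultimately show ?thesis
    by (simp add: INF_less_iff)
qed

lemma cap_eq_0_iff:
  "cap X \<xi> emb E = 0 \<longleftrightarrow> (\<forall>e>0. \<exists>v. cap_test v E \<and> norm v < e)"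
proof
  assume "cap X \<xi> emb E = 0"
  then show "\<forall>e>0. \<exists>v. cap_test v E \<and> norm v < e"
    by (metis cap_less_iff ennreal_less_zero_iff zero_less_power)
next
  assume *: "\<forall>e>0. \<exists>v. cap_test v E \<and> norm v < e"
  show "cap X \<xi> emb E = 0"
  proof (rule ccontr)
    assume "cap X \<xi> emb E \<noteq> 0"
    then have "0 < cap X \<xi> emb E" by (simp add: zero_less_iff_neq_zero)
    \<comment> \<open>The capacity may be infinite, so a finite \<open>s\<close> strictly between 0
      and it is chosen; a test element of norm below \<open>sqrt s\<close> then gives the
      contradiction.\<close>
    then obtain y where y: "0 < y" "y < cap X \<xi> emb E" using dense by blast
    then obtain s where "s \<ge> 0" "y = ennreal s" by (cases y) auto
    with y have s: "ennreal s < cap X \<xi> emb E" and "s > 0" by auto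
    then have "cap X \<xi> emb E < ennreal ((sqrt s)\<^sup>2)"
      using * by (subst cap_less_iff) auto
    with s \<open>s > 0\<close> show False by simp
  qed
qed

lemma cap_test_mono: "cap_test v E \<Longrightarrow> E' \<subseteq> E \<Longrightarrow> cap_test v E'"
  unfolding cap_test_def by blast

text \<open>The norm of V need not make the capacity itself subadditive; its square root is
  countably subadditive up to the constant of the positive part, because the sum of the
  positive parts dominates each test function.\<close>

lemma cap_test_UN:
  obtains \<kappa> where "\<kappa> > 0"
    "\<And>v E b. (\<And>n::nat. cap_test (v n) (E n)) \<Longrightarrow> (\<And>n. norm (v n) \<le> b n) \<Longrightarrow> summable b \<Longrightarrow>
      \<exists>w. cap_test w (\<Union>n. E n) \<and> norm w \<le> \<kappa> * suminf b"
proof -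
  obtain \<kappa> where \<kappa>: "\<kappa> > 0"
    and bound: "\<And>v p. (AE x in \<xi>. emb p x = max (emb v x) 0) \<Longrightarrow> norm p \<le> \<kappa> * norm v"
    using pos_part_bound by blast
  have "\<exists>w. cap_test w (\<Union>n. E n) \<and> norm w \<le> \<kappa> * suminf b"
    if test: "\<And>n::nat. cap_test (v n) (E n)" and vb: "\<And>n. norm (v n) \<le> b n" and b: "summable b"
    for v E b
  proof -
    have "\<exists>p. AE x in \<xi>. emb p x = max (emb (v n) x) 0" for n
    proof -
      obtain w where "AE x in \<xi>. emb w x = \<bar>emb (v n) x\<bar>" using abs_closed by blast
      with emb_linear[of "1/2" w "1/2" "v n"]
      have "AE x in \<xi>. emb ((1/2) *\<^sub>R w + (1/2) *\<^sub>R v n) x = max (emb (v n) x) 0"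
        by eventually_elim simp
      then show ?thesis by blast
    qed
    then obtain p where p: "\<And>n. AE x in \<xi>. emb (p n) x = max (emb (v n) x) 0" by metis
    have "norm (p n) \<le> \<kappa> * b n" for n
      using bound[OF p[of n]] vb[of n] \<kappa> by (meson mult_left_mono order_trans less_imp_le)
    then obtain s where s: "p sums s" "norm s \<le> (\<Sum>n. \<kappa> * b n)"
      by (rule sums_if_norm_le_summable[OF summable_mult[OF b]])
    \<comment> \<open>Convergence of the series in V controls pointwise values only along a
      subsequence of the partial sums.\<close>
    obtain r :: "nat \<Rightarrow> nat" where r: "strict_mono r"
      and lim: "AE x in \<xi>. (\<lambda>n. emb (\<Sum>i<r n. p i) x) \<longlonglongrightarrow> emb s x"
      by (rule emb_AE_subseq[OF s(1)[unfolded sums_def]])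
    have "AE x in \<xi>. \<forall>n. emb (\<Sum>i<r n. p i) x = (\<Sum>i<r n. emb (p i) x)"
      unfolding AE_all_countable using emb_sum by blast
    moreover have "AE x in \<xi>. \<forall>n. emb (p n) x = max (emb (v n) x) 0"
      unfolding AE_all_countable using p by blast
    ultimately have ge: "AE x in \<xi>. \<forall>n. emb (v n) x \<le> emb s x"
      using lim
    proof eventually_elim
      case (elim x)
      show ?case
      proof
        fix n
        \<comment> \<open>Since \<open>r m \<ge> m > n\<close>, the term \<open>p n\<close> is among
          the summands, and all the others are nonnegative.\<close>
        have "emb (v n) x \<le> emb (\<Sum>i<r m. p i) x" if "m \<ge> Suc n" for m
        proof -
          have "n < r m" using that seq_suble[OF r, of m] by linarith
          then have "emb (p n) x \<le> (\<Sum>i<r m. emb (p i) x)"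
            by (intro member_le_sum) (auto simp: elim(2))
          then show ?thesis using elim by simp
        qed
        then show "emb (v n) x \<le> emb s x"
          by (intro Lim_bounded2[OF elim(3)]) blast
      qed
    qed
    obtain U where U: "\<And>n. openin X (U n)" "\<And>n. E n \<subseteq> U n"
      "\<And>n. AE x in \<xi>. x \<in> U n \<longrightarrow> 1 \<le> emb (v n) x"
      using test unfolding cap_test_def by metis
    have "AE x in \<xi>. \<forall>n. x \<in> U n \<longrightarrow> 1 \<le> emb (v n) x"
      unfolding AE_all_countable using U(3) by blast
    with ge have "AE x in \<xi>. x \<in> (\<Union>n. U n) \<longrightarrow> 1 \<le> emb s x"
      by eventually_elim (auto intro: order_trans)
    moreover have "openin X (\<Union>n. U n)" "(\<Union>n. E n) \<subseteq> (\<Union>n. U n)"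
      using U(1,2) by blast+
    ultimately have "cap_test s (\<Union>n. E n)" unfolding cap_test_def by blast
    with s(2) suminf_mult[OF b] show ?thesis by metis
  qed
  with \<kappa> that show ?thesis by blast
qed

lemma cap_test_empty: "cap_test 0 {}"
  unfolding cap_test_def by (intro exI[of _ "{}"]) auto

text \<open>Padding the pair with zero elements and empty sets makes this a case of the countable
  estimate.\<close>

lemma cap_test_Un:
  obtains \<kappa> where "\<kappa> > 0"
    "\<And>v w E E'. cap_test v E \<Longrightarrow> cap_test w E' \<Longrightarrow>
      \<exists>y. cap_test y (E \<union> E') \<and> norm y \<le> \<kappa> * (norm v + norm w)"
proof (rule cap_test_UN)
  fix \<kappa> :: real assume \<kappa>: "\<kappa> > 0"
    and UN: "\<And>v E b. (\<And>n::nat. cap_test (v n) (E n)) \<Longrightarrow> (\<And>n. norm (v n) \<le> b n) \<Longrightarrow> summable b \<Longrightarrow>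
      \<exists>w. cap_test w (\<Union>n. E n) \<and> norm w \<le> \<kappa> * suminf b"
  have "\<exists>y. cap_test y (E \<union> E') \<and> norm y \<le> \<kappa> * (norm v + norm w)"
    if "cap_test v E" "cap_test w E'" for v w E E'
  proof -
    define c where "c = (\<lambda>n::nat. if n = 0 then v else if n = 1 then w else 0)"
    define B where "B = (\<lambda>n::nat. if n = 0 then E else if n = 1 then E' else {})"
    have "(\<lambda>n. norm (c n)) sums (\<Sum>n<2. norm (c n))"
      by (rule sums_finite) (auto simp: c_def)
    then have "(\<lambda>n. norm (c n)) sums (norm v + norm w)"
      by (simp add: c_def numeral_2_eq_2)
    moreover have "(\<Union>n. B n) = E \<union> E'" by (auto simp: B_def split: if_splits)
    moreover have "cap_test (c n) (B n)" for n using that cap_test_empty by (simp add: c_def B_def)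
    ultimately show ?thesis
      using UN[of c B "\<lambda>n. norm (c n)"] by (simp add: sums_iff)
  qed
  with \<kappa> that show thesis by blast
qed

lemma cap_0_Un:
  assumes "cap X \<xi> emb E = 0" "cap X \<xi> emb E' = 0"
  shows "cap X \<xi> emb (E \<union> E') = 0"
  unfolding cap_eq_0_iff
proof (intro allI impI)
  fix e :: real assume e: "e > 0"
  obtain \<kappa> where \<kappa>: "\<kappa> > 0" and Un: "\<And>v w E E'. cap_test v E \<Longrightarrow> cap_test w E' \<Longrightarrow>
      \<exists>y. cap_test y (E \<union> E') \<and> norm y \<le> \<kappa> * (norm v + norm w)"
    using cap_test_Un by blast
  have "e / (2 * \<kappa>) > 0" using e \<kappa> by simp
  then obtain v w where v: "cap_test v E" "norm v < e / (2 * \<kappa>)"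
    and w: "cap_test w E'" "norm w < e / (2 * \<kappa>)"
    using assms unfolding cap_eq_0_iff by blast
  have "\<kappa> * (norm v + norm w) < \<kappa> * (e / (2 * \<kappa>) + e / (2 * \<kappa>))"
    using v(2) w(2) \<kappa> by (intro mult_strict_left_mono) auto
  also have "\<dots> = e" using \<kappa> by (simp add: field_simps)
  finally show "\<exists>y. cap_test y (E \<union> E') \<and> norm y < e"
    using Un[OF v(1) w(1)] by (meson le_less_trans)
qed

lemma cap_0_mono: "cap X \<xi> emb E = 0 \<Longrightarrow> E' \<subseteq> E \<Longrightarrow> cap X \<xi> emb E' = 0"
  unfolding cap_eq_0_iff by (blast intro: cap_test_mono)

text \<open>The points where \<open>R\<close> fails lie in the union of the two exceptional sets.
  This is the rule for pointwise reasoning quasi-everywhere; feeding it the same fact twice weakens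
  that fact.\<close>

lemma qe_on_mp:
  assumes "qe_on X \<xi> emb E P" "qe_on X \<xi> emb E Q" "\<And>x. x \<in> E \<Longrightarrow> P x \<Longrightarrow> Q x \<Longrightarrow> R x"
  shows "qe_on X \<xi> emb E R"
  unfolding qe_on_def
  by (rule cap_0_mono[OF cap_0_Un[OF assms(1,2)[unfolded qe_on_def]]]) (use assms(3) in blast)

lemma qe_on_subset: "qe_on X \<xi> emb E P \<Longrightarrow> E' \<subseteq> E \<Longrightarrow> qe_on X \<xi> emb E' P"
  unfolding qe_on_def by (rule cap_0_mono) auto

section \<open>Quasi-continuous functions\<close>

text \<open>As \<open>e\<close> is arbitrary, smallness of the capacity and of the norm of a test
  element are interchangeable, through \<open>e\<^sup>2\<close> in one direction and
  \<open>sqrt e\<close> in the other.\<close>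

lemma quasi_continuous_iff:
  "quasi_continuous X \<xi> emb g \<longleftrightarrow>
     (\<forall>e>0. \<exists>G v. openin X G \<and> cap_test v G \<and> norm v < e \<and>
        continuous_map (subtopology X (topspace X - G)) euclideanreal g)"
    (is "?L \<longleftrightarrow> ?R")
proof
  assume ?L
  show ?R
  proof (intro allI impI)
    fix e :: real assume e: "e > 0"
    then have "e\<^sup>2 > 0" by simp
    with \<open>?L\<close> obtain G where "openin X G" "cap X \<xi> emb G < ennreal (e\<^sup>2)"
      "continuous_map (subtopology X (topspace X - G)) euclideanreal g"
      unfolding quasi_continuous_def by blast
    then show "\<exists>G v. openin X G \<and> cap_test v G \<and> norm v < e \<and>
        continuous_map (subtopology X (topspace X - G)) euclideanreal g"
      using cap_less_iff[OF e, of G] by blast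
  qed
next
  assume R: ?R
  show ?L unfolding quasi_continuous_def
  proof (intro allI impI)
    fix e :: real assume "e > 0"
    then have e: "sqrt e > 0" "(sqrt e)\<^sup>2 = e" by auto
    obtain G v where "openin X G" "cap_test v G" "norm v < sqrt e"
      "continuous_map (subtopology X (topspace X - G)) euclideanreal g"
      using R e(1) by blast
    then show "\<exists>G. openin X G \<and> cap X \<xi> emb G < ennreal e \<and>
        continuous_map (subtopology X (topspace X - G)) euclideanreal g"
      using cap_less_iff[OF e(1), of G, unfolded e(2)] by blast
  qed
qed

text \<open>Both functions are continuous off the union of their exceptional open sets, and this
  union again has a test element of small norm.\<close>

lemma quasi_continuous_linear:
  assumes "quasi_continuous X \<xi> emb g" "quasi_continuous X \<xi> emb h"
  shows "quasi_continuous X \<xi> emb (\<lambda>x. a * g x + b * h x)"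
  unfolding quasi_continuous_iff
proof (intro allI impI)
  fix e :: real assume e: "e > 0"
  obtain \<kappa> where \<kappa>: "\<kappa> > 0" and Un: "\<And>v w E E'. cap_test v E \<Longrightarrow> cap_test w E' \<Longrightarrow>
      \<exists>y. cap_test y (E \<union> E') \<and> norm y \<le> \<kappa> * (norm v + norm w)"
    using cap_test_Un by blast
  have e': "e / (2 * \<kappa>) > 0" using e \<kappa> by simp
  obtain G v where G: "openin X G" "cap_test v G" "norm v < e / (2 * \<kappa>)"
    "continuous_map (subtopology X (topspace X - G)) euclideanreal g"
    using assms(1) e' unfolding quasi_continuous_iff by blast
  obtain G' w where G': "openin X G'" "cap_test w G'" "norm w < e / (2 * \<kappa>)"
    "continuous_map (subtopology X (topspace X - G')) euclideanreal h"
    using assms(2) e' unfolding quasi_continuous_iff by blast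
  obtain y where y: "cap_test y (G \<union> G')" "norm y \<le> \<kappa> * (norm v + norm w)"
    using Un[OF G(2) G'(2)] by blast
  have "\<kappa> * (norm v + norm w) < \<kappa> * (e / (2 * \<kappa>) + e / (2 * \<kappa>))"
    using G(3) G'(3) \<kappa> by (intro mult_strict_left_mono) auto
  also have "\<dots> = e" using \<kappa> by (simp add: field_simps)
  finally have "norm y < e" using y(2) by linarith
  moreover have "continuous_map (subtopology X (topspace X - (G \<union> G'))) euclideanreal g"
    "continuous_map (subtopology X (topspace X - (G \<union> G'))) euclideanreal h"
    using G(4) G'(4) by (auto elim!: continuous_map_from_subtopology_mono)
  then have "continuous_map (subtopology X (topspace X - (G \<union> G'))) euclideanreal
      (\<lambda>x. a * g x + b * h x)"
    by (intro continuous_intros)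
  ultimately show "\<exists>G v. openin X G \<and> cap_test v G \<and> norm v < e \<and>
        continuous_map (subtopology X (topspace X - G)) euclideanreal (\<lambda>x. a * g x + b * h x)"
    using G(1) G'(1) y(1) by (meson openin_Un)
qed

text \<open>Applied to differences, this yields uniqueness of quasi-continuous representatives up to
  capacity zero.\<close>

lemma quasi_continuous_AE_0_imp_qe_0:
  assumes g: "quasi_continuous X \<xi> emb g" and g0: "AE x in \<xi>. g x = 0"
  shows "qe_on X \<xi> emb (topspace X) (\<lambda>x. g x = 0)"
  unfolding qe_on_def cap_eq_0_iff
proof (intro allI impI)
  fix e :: real assume "e > 0"
  then obtain G v where G: "openin X G" "cap_test v G" "norm v < e"
    "continuous_map (subtopology X (topspace X - G)) euclideanreal g"
    using g unfolding quasi_continuous_iff by blast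
  obtain U where U: "openin X U" "G \<subseteq> U" "AE x in \<xi>. x \<in> U \<longrightarrow> 1 \<le> emb v x"
    using G(2) unfolding cap_test_def by blast
  have "openin (subtopology X (topspace X - G))
      {x \<in> topspace (subtopology X (topspace X - G)). g x \<in> - {0}}"
    by (rule openin_continuous_map_preimage[OF G(4)]) (auto simp: open_Compl)
  then obtain T where T: "openin X T"
    "{x \<in> topspace X - G. g x \<noteq> 0} = T \<inter> (topspace X - G)"
    unfolding openin_subtopology by auto
  \<comment> \<open>The set where \<open>g\<close> does not vanish is open up to \<open>G\<close> and null outside \<open>G\<close>,
    hence \<open>v\<close> is also a test function for it.\<close>
  have "{x \<in> topspace X. g x \<noteq> 0} \<subseteq> T \<union> U" using T(2) U(2) by blast
  moreover have "AE x in \<xi>. x \<in> T \<union> U \<longrightarrow> 1 \<le> emb v x"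
    using g0 U(3)
  proof eventually_elim
    case (elim x)
    then show ?case using T U(2) openin_subset[OF T(1)] by blast
  qed
  ultimately have "cap_test v {x \<in> topspace X. g x \<noteq> 0}"
    unfolding cap_test_def using T(1) U(1) by blast
  with G(3) show "\<exists>v. cap_test v {x \<in> topspace X. g x \<noteq> 0} \<and> norm v < e" by blast
qed

section \<open>Existence and linearity of quasi-continuous representatives\<close>

text \<open>Continuous approximations that converge fast in V converge uniformly off open sets of
  arbitrarily small capacity, so their pointwise limit is quasi-continuous; a subsequence identifies
  it with \<open>emb v\<close> almost everywhere.\<close>

lemma quasi_continuous_representative_exists:
  "\<exists>g. quasi_continuous X \<xi> emb g \<and> (AE x in \<xi>. g x = emb v x)"
proof -
  obtain \<kappa> where \<kappa>: "\<kappa> > 0" and UN: "\<And>v E b. (\<And>n::nat. cap_test (v n) (E n)) \<Longrightarrow>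
      (\<And>n. norm (v n) \<le> b n) \<Longrightarrow> summable b \<Longrightarrow>
      \<exists>w. cap_test w (\<Union>n. E n) \<and> norm w \<le> \<kappa> * suminf b"
    using cap_test_UN by blast
  \<comment> \<open>The rate 1/4 leaves room for the factor \<open>2^n\<close> spent below: a
    summable 1/2 rate remains.\<close>
  have "\<exists>w h. h \<in> Cc X \<and> (AE x in \<xi>. emb w x = h x) \<and> norm (v - w) < (1/4)^n" for n :: nat
    using Cc_dense[of "(1/4)^n" v] by auto
  then obtain w h where Cc: "\<And>n. h n \<in> Cc X" and wh: "\<And>n. AE x in \<xi>. emb (w n) x = h n x"
    and vw: "\<And>n::nat. norm (v - w n) < (1/4)^n"
    by metis
  have h_cont: "continuous_map X euclideanreal (h n)" for n
    using Cc[of n] by (simp add: Cc_def)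
  define G where "G = (\<lambda>n. {x \<in> topspace X. (1/2)^n < \<bar>h (Suc n) x - h n x\<bar>})"
  have G_open: "openin X (G n)" for n
  proof -
    have "continuous_map X euclideanreal (\<lambda>x. \<bar>h (Suc n) x - h n x\<bar>)"
      using h_cont by (intro continuous_intros)
    from openin_continuous_map_preimage[OF this, of "{(1/2)^n<..}"]
    show ?thesis by (simp add: G_def)
  qed
  obtain \<mu> where \<mu>: "\<mu> > 0" and abs_bound: "\<And>d a. (AE x in \<xi>. emb a x = \<bar>emb d x\<bar>) \<Longrightarrow> norm a \<le> \<mu> * norm d"
    using emb_abs_bound by blast
  \<comment> \<open>A Chebyshev estimate: on \<open>G n\<close> the modulus of the increment exceeds
    \<open>(1/2)^n\<close>, so \<open>2^n\<close> times the element of V representing this modulus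
    is a test element.\<close>
  have "\<exists>y. cap_test y (G n) \<and> norm y \<le> 2 * \<mu> * (1/2)^n" for n
  proof -
    let ?d = "w (Suc n) - w n"
    obtain a where a: "AE x in \<xi>. emb a x = \<bar>emb ?d x\<bar>" using abs_closed by blast
    have "norm ?d \<le> norm (v - w n) + norm (v - w (Suc n))"
      using norm_triangle_ineq4[of "v - w n" "v - w (Suc n)"] by simp
    also have "\<dots> \<le> 2 * (1/4)^n"
      using vw[of n] vw[of "Suc n"] zero_le_power[of "1/4::real" n] unfolding power_Suc by linarith
    finally have "norm a \<le> \<mu> * (2 * (1/4)^n)"
      using abs_bound[OF a] \<mu> by (meson mult_left_mono order_trans less_imp_le)
    then have "norm (2^n *\<^sub>R a) \<le> 2^n * (\<mu> * (2 * (1/4)^n))" by simp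
    also have "\<dots> = 2 * \<mu> * (2 * (1/4))^n" unfolding power_mult_distrib by simp
    finally have "norm (2^n *\<^sub>R a) \<le> 2 * \<mu> * (1/2)^n" by simp
    moreover have "AE x in \<xi>. x \<in> G n \<longrightarrow> 1 \<le> emb (2^n *\<^sub>R a) x"
      using a emb_scaleR[of "2^n" a] emb_diff[of "w (Suc n)" "w n"] wh[of n] wh[of "Suc n"]
      by eventually_elim (auto simp: G_def field_simps)
    ultimately show ?thesis using G_open unfolding cap_test_def by blast
  qed
  then obtain y where y: "\<And>n. cap_test (y n) (G n)" "\<And>n. norm (y n) \<le> 2 * \<mu> * (1/2)^n"
    by metis
  \<comment> \<open>Off \<open>T N\<close> every increment from index \<open>N\<close> on is small.
    The geometric tail of the bounds on \<open>y\<close> gives \<open>T N\<close> a test element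
    whose norm tends to 0.\<close>
  define T where "T = (\<lambda>N. \<Union>k. G (N + k))"
  have T_open: "openin X (T N)" for N unfolding T_def using G_open by blast
  have "\<exists>z. cap_test z (T N) \<and> norm z \<le> \<kappa> * (4 * \<mu> * (1/2)^N)" for N
  proof -
    have "(\<lambda>k. (2 * \<mu> * (1/2)^N) * (1/2)^k) sums ((2 * \<mu> * (1/2)^N) * 2)"
      using geometric_sums[of "1/2::real"] by (intro sums_mult) simp
    then have "(\<lambda>k. 2 * \<mu> * (1/2)^(N + k)) sums (4 * \<mu> * (1/2)^N)"
      by (simp add: power_add mult_ac)
    then show ?thesis
      using UN[of "\<lambda>k. y (N + k)" "\<lambda>k. G (N + k)" "\<lambda>k. 2 * \<mu> * (1/2)^(N + k)"] y
      by (simp add: sums_iff T_def)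
  qed
  then obtain z where z: "\<And>N. cap_test (z N) (T N)" "\<And>N. norm (z N) \<le> \<kappa> * (4 * \<mu> * (1/2)^N)"
    by metis
  have "(\<lambda>N. \<kappa> * (4 * \<mu> * (1/2::real)^N)) \<longlonglongrightarrow> 0"
    by (intro tendsto_mult_right_zero LIMSEQ_realpow_zero) auto
  then have z0: "z \<longlonglongrightarrow> 0"
    by (rule Lim_null_comparison[rotated]) (use z(2) in auto)
  \<comment> \<open>The limit may fail to exist, and \<open>lim\<close> be junk, only on \<open>\<Inter>N. T N\<close>, which has capacity zero.\<close>
  define g where "g = (\<lambda>x. lim (\<lambda>n. h n x))"
  \<comment> \<open>Off \<open>T N\<close> the telescoping series of increments is dominated by a
    geometric one, whose tail from \<open>n\<close> is \<open>2 * (1/2)^n\<close>, independently of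
    \<open>x\<close>.\<close>
  have unif: "\<bar>h n x - g x\<bar> \<le> 2 * (1/2)^n \<and> (\<lambda>n. h n x) \<longlonglongrightarrow> g x"
    if x: "x \<in> topspace X" "x \<notin> T N" and n: "n \<ge> N" for x n N
  proof -
    let ?a = "\<lambda>k. h (Suc (n + k)) x - h (n + k) x"
    have le: "norm (?a k) \<le> (1/2)^(n + k)" for k
    proof -
      have "x \<notin> G (N + (n - N + k))" using x(2) unfolding T_def by blast
      then show ?thesis using n x(1) by (simp add: G_def not_less)
    qed
    have "(\<lambda>k. (1/2::real)^n * (1/2)^k) sums ((1/2)^n * 2)"
      using geometric_sums[of "1/2::real"] by (intro sums_mult) simp
    then have b: "(\<lambda>k. (1/2::real)^(n + k)) sums (2 * (1/2)^n)"
      by (simp add: power_add mult_ac)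
    obtain s where s: "?a sums s" "norm s \<le> 2 * (1/2)^n"
      using sums_if_norm_le_summable[OF sums_summable[OF b], of ?a] le sums_unique[OF b] by metis
    have "(\<Sum>k<m. ?a k) = h (n + m) x - h n x" for m
      using sum_lessThan_telescope[of "\<lambda>k. h (n + k) x" m] by simp
    then have "(\<lambda>m. h (n + m) x - h n x) \<longlonglongrightarrow> s"
      using s(1) by (simp add: sums_def)
    from tendsto_add[OF this tendsto_const[of "h n x"]]
    have "(\<lambda>m. h (m + n) x) \<longlonglongrightarrow> s + h n x" by (simp add: add.commute)
    then have lim: "(\<lambda>m. h m x) \<longlonglongrightarrow> s + h n x" by (rule LIMSEQ_offset)
    then have "g x = s + h n x" unfolding g_def by (rule limI)
    with lim s(2) show ?thesis by simp
  qed
  have "quasi_continuous X \<xi> emb g"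
    unfolding quasi_continuous_iff
  proof (intro allI impI)
    fix e :: real assume "e > 0"
    then have "eventually (\<lambda>N. norm (z N) < e) sequentially"
      by (rule order_tendstoD(2)[OF tendsto_norm_zero[OF z0]])
    then obtain N where N: "norm (z N) < e" by (auto simp: eventually_sequentially)
    let ?Y = "subtopology X (topspace X - T N)"
    \<comment> \<open>The uniform limit theorem is stated for a metric codomain;
      \<open>Met_TC.mtopology\<close> on the reals is \<open>euclideanreal\<close>.\<close>
    have "continuous_map ?Y Met_TC.mtopology g"
    proof (rule Met_TC.continuous_map_uniform_limit[where F=sequentially and f=h])
      show "\<forall>\<^sub>F n in sequentially. continuous_map ?Y Met_TC.mtopology (h n)"
        using h_cont by (simp add: continuous_map_from_subtopology)
      fix \<epsilon> :: real assume "\<epsilon> > 0"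
      moreover have "(\<lambda>n. 2 * (1/2::real)^n) \<longlonglongrightarrow> 0"
        by (intro tendsto_mult_right_zero LIMSEQ_realpow_zero) auto
      ultimately have "\<forall>\<^sub>F n in sequentially. 2 * (1/2::real)^n < \<epsilon>"
        by (rule order_tendstoD(2)[rotated])
      then show "\<forall>\<^sub>F n in sequentially. \<forall>x\<in>topspace ?Y. g x \<in> UNIV \<and> dist (h n x) (g x) < \<epsilon>"
        using eventually_ge_at_top[of N]
      proof eventually_elim
        case (elim n)
        show ?case
        proof
          fix x assume "x \<in> topspace ?Y"
          then show "g x \<in> UNIV \<and> dist (h n x) (g x) < \<epsilon>"
            using unif[of x N n] elim by (auto simp: dist_real_def)
        qed
      qed
    qed auto
    then have "continuous_map ?Y euclideanreal g" by simp
    with N z(1) T_open show "\<exists>G v. openin X G \<and> cap_test v G \<and> norm v < e \<and>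
        continuous_map (subtopology X (topspace X - G)) euclideanreal g" by blast
  qed
  moreover have "AE x in \<xi>. g x = emb v x"
  proof -
    have "(\<lambda>n. w n - v) \<longlonglongrightarrow> 0"
    proof (rule Lim_null_comparison)
      show "\<forall>\<^sub>F n in sequentially. norm (w n - v) \<le> (1/4)^n"
        using vw by (simp add: norm_minus_commute less_imp_le)
      show "(\<lambda>n. (1/4::real)^n) \<longlonglongrightarrow> 0" by (rule LIMSEQ_realpow_zero) auto
    qed
    then have "w \<longlonglongrightarrow> v" using LIM_zero_iff by blast
    then obtain r :: "nat \<Rightarrow> nat" where r: "strict_mono r"
      and r_lim: "AE x in \<xi>. (\<lambda>n. emb (w (r n)) x) \<longlonglongrightarrow> emb v x"
      using emb_AE_subseq by blast
    \<comment> \<open>Along \<rho> the test elements tend to 0 almost everywhere, although they are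
      at least 1 on \<open>T (\<rho> n)\<close>; so almost every point lies outside some
      \<open>T (\<rho> n)\<close>, where the approximations converge to \<open>g\<close>.\<close>
    obtain \<rho> :: "nat \<Rightarrow> nat" where \<rho>: "AE x in \<xi>. (\<lambda>n. emb (z (\<rho> n)) x) \<longlonglongrightarrow> emb 0 x"
      using emb_AE_subseq[OF z0] by blast
    have "AE x in \<xi>. \<forall>n. x \<in> T n \<longrightarrow> 1 \<le> emb (z n) x"
      unfolding AE_all_countable using z(1) unfolding cap_test_def by fastforce
    moreover have "AE x in \<xi>. \<forall>n. emb (w n) x = h n x"
      unfolding AE_all_countable using wh by blast
    moreover have "AE x in \<xi>. emb 0 x = 0" using emb_scaleR[of 0 0] by simp
    moreover have "AE x in \<xi>. x \<in> topspace X"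
      using radon AE_space[of \<xi>] by (simp add: radon_measure_def)
    ultimately show ?thesis using r_lim \<rho>
    proof eventually_elim
      case (elim x)
      have "\<exists>n. x \<notin> T (\<rho> n)"
      proof (rule ccontr)
        assume "\<not> ?thesis"
        then have "\<And>n. 1 \<le> emb (z (\<rho> n)) x" using elim(1) by blast
        then have "1 \<le> emb 0 x" by (intro Lim_bounded2[OF elim(6), of 0]) blast
        with elim(3) show False by simp
      qed
      then obtain n where "x \<notin> T (\<rho> n)" by blast
      with elim(4) have "(\<lambda>n. h n x) \<longlonglongrightarrow> g x" using unif by blast
      then have "(\<lambda>n. h (r n) x) \<longlonglongrightarrow> g x"
        using r LIMSEQ_subseq_LIMSEQ[of "\<lambda>n. h n x" "g x" r] by (simp add: o_def)
      with elim(2,5) show ?case using LIMSEQ_unique by simp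
    qed
  qed
  ultimately show ?thesis by blast
qed

lemma qc_rep:
  shows quasi_continuous_qc_rep: "quasi_continuous X \<xi> emb (qc_rep X \<xi> emb v)"
    and AE_qc_rep: "AE x in \<xi>. qc_rep X \<xi> emb v x = emb v x"
  using someI_ex[OF quasi_continuous_representative_exists[of v]]
  unfolding qc_rep_def by blast+

text \<open>The defect of linearity is quasi-continuous and vanishes almost everywhere, hence
  quasi-everywhere. The factors 1 and -1 give it the shape handled by
  \<open>quasi_continuous_linear\<close>.\<close>

lemma qc_rep_linear:
  "qe_on X \<xi> emb (topspace X)
     (\<lambda>x. qc_rep X \<xi> emb (a *\<^sub>R v + b *\<^sub>R w) x = a * qc_rep X \<xi> emb v x + b * qc_rep X \<xi> emb w x)"
proof -
  let ?g = "\<lambda>x. 1 * qc_rep X \<xi> emb (a *\<^sub>R v + b *\<^sub>R w) x +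
    (-1) * (a * qc_rep X \<xi> emb v x + b * qc_rep X \<xi> emb w x)"
  have "quasi_continuous X \<xi> emb ?g"
    by (intro quasi_continuous_linear quasi_continuous_qc_rep)
  moreover have "AE x in \<xi>. ?g x = 0"
    using AE_qc_rep[of v] AE_qc_rep[of w] AE_qc_rep[of "a *\<^sub>R v + b *\<^sub>R w"] emb_linear[of a v b w]
    by eventually_elim simp
  ultimately have "qe_on X \<xi> emb (topspace X) (\<lambda>x. ?g x = 0)"
    by (rule quasi_continuous_AE_0_imp_qe_0)
  from qe_on_mp[OF this this] show ?thesis by simp
qed

text \<open>With derivatives of the obstacle map as \<open>v'\<close> and \<open>w'\<close>, this
  lets membership in \<open>S_set\<close> pass to linear combinations.\<close>

lemma qc_rep_eq_linear:
  assumes "E \<subseteq> topspace X"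
    and "qe_on X \<xi> emb E (\<lambda>x. qc_rep X \<xi> emb v x = qc_rep X \<xi> emb v' x)"
    and "qe_on X \<xi> emb E (\<lambda>x. qc_rep X \<xi> emb w x = qc_rep X \<xi> emb w' x)"
  shows "qe_on X \<xi> emb E
    (\<lambda>x. qc_rep X \<xi> emb (a *\<^sub>R v + b *\<^sub>R w) x = qc_rep X \<xi> emb (a *\<^sub>R v' + b *\<^sub>R w') x)"
proof -
  note lin = qe_on_subset[OF qc_rep_linear assms(1)]
  have "qe_on X \<xi> emb E (\<lambda>x. qc_rep X \<xi> emb (a *\<^sub>R v + b *\<^sub>R w) x =
      a * qc_rep X \<xi> emb v' x + b * qc_rep X \<xi> emb w' x)"
    by (rule qe_on_mp[OF lin[of a v b w]
          qe_on_mp[OF assms(2,3), of "\<lambda>x. qc_rep X \<xi> emb v x = qc_rep X \<xi> emb v' x \<and>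
            qc_rep X \<xi> emb w x = qc_rep X \<xi> emb w' x"]]) auto
  then show ?thesis by (rule qe_on_mp[OF lin[of a v' b w']]) auto
qed

end

section \<open>The linearised problem under strict complementarity\<close>

theorem theorem1p7:
  fixes X :: "'x topology" and \<xi> :: "'x measure"
    and emb :: "'v::{real_inner, complete_space} \<Rightarrow> 'x \<Rightarrow> real"
    and A :: "'v \<Rightarrow> ('v \<Rightarrow>\<^sub>L real)" and Ca Cb :: real
    and \<Phi> :: "('x \<Rightarrow> real) \<Rightarrow> 'v" and F :: "'v \<Rightarrow> 'v"
    and f :: "'v \<Rightarrow>\<^sub>L real" and u ubar :: 'v
    and D :: "('v \<Rightarrow>\<^sub>L real) set"
    and \<Omega> :: "'n::euclidean_space set" and \<iota> :: "'n \<Rightarrow> 'x"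
  assumes setting: "obstacle_setting X \<xi> emb A Ca Cb \<Phi>"
    and F: "F = (\<lambda>v. \<Phi> (emb v))"
    and f: "f \<in> dual_plus \<xi> emb"
    and u: "u \<in> Q_set \<xi> emb A \<Phi> f"
    and ubar: "A ubar = f"
    and u_nonneg: "AE x in \<xi>. 0 \<le> emb u x"
    and u_le_ubar: "AE x in \<xi>. emb u x \<le> emb ubar x"
    and A1: "hadamard_differentiable F"
    and A2: "completely_continuous F \<and> D = dual_plus \<xi> emb \<or>
             assumption_A2b \<Omega> \<iota> X \<xi> emb \<Phi> \<and> f \<in> Linf_dual_plus \<xi> emb \<and>
             D = Linf_dual_plus \<xi> emb"
    and A3: "\<And>v. completely_continuous (hadamard_deriv F v)"
    and A4: "assumption_A4 F u"
    and A5: "assumption_A5 F Ca Cb u"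
    and strict_complementarity:
      "\<And>w. crit_set X \<xi> emb A F f u w = S_set X \<xi> emb F u w"
  shows "(\<forall>d\<in>D. \<forall>\<alpha>. qvi_dir_derivative X \<xi> emb A \<Phi> f u d \<alpha> \<longrightarrow>
            \<alpha> \<in> S_set X \<xi> emb F u \<alpha> \<and>
            (\<forall>v\<in>S_set X \<xi> emb F u \<alpha>. (A \<alpha> - d) (\<alpha> - v) = 0)) \<and>
         ((\<forall>v. linear (hadamard_deriv F v)) \<longrightarrow>
            (\<forall>d1\<in>D. \<forall>d2\<in>D. \<forall>c1>0. \<forall>c2>0. \<forall>\<alpha>1 \<alpha>2 \<alpha>.
               qvi_dir_derivative X \<xi> emb A \<Phi> f u d1 \<alpha>1 \<longrightarrow>
               qvi_dir_derivative X \<xi> emb A \<Phi> f u d2 \<alpha>2 \<longrightarrow>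
               qvi_dir_derivative X \<xi> emb A \<Phi> f u (c1 *\<^sub>R d1 + c2 *\<^sub>R d2) \<alpha> \<longrightarrow>
               \<alpha> = c1 *\<^sub>R \<alpha>1 + c2 *\<^sub>R \<alpha>2))"
proof -
  interpret obstacle_setting X \<xi> emb A Ca Cb \<Phi> by (rule setting)
  let ?S = "S_set X \<xi> emb F u"
  let ?G = "hadamard_deriv F u"
  let ?E = "coincidence_set X \<xi> emb F u"
  have E: "?E \<subseteq> topspace X" unfolding coincidence_set_def by blast
  have S_iff: "\<phi> \<in> ?S w \<longleftrightarrow>
      qe_on X \<xi> emb ?E (\<lambda>x. qc_rep X \<xi> emb \<phi> x = qc_rep X \<xi> emb (?G w) x)" for \<phi> w
    by (simp add: S_set_def)
  have part1: "\<alpha> \<in> ?S \<alpha>" "\<And>v. v \<in> ?S \<alpha> \<Longrightarrow> (A \<alpha> - d) (\<alpha> - v) = 0"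
    if "qvi_dir_derivative X \<xi> emb A \<Phi> f u d \<alpha>" for d \<alpha>
  proof -
    \<comment> \<open>Strict complementarity at \<open>w = \<alpha>\<close>, read from right to
      left, turns the goal into membership in \<open>crit_set\<close>.\<close>
    from that show \<alpha>: "\<alpha> \<in> ?S \<alpha>"
      unfolding qvi_dir_derivative_def by (simp flip: F strict_complementarity)
    have le: "(A \<alpha> - d) (\<alpha> - v) \<le> 0" if "v \<in> ?S \<alpha>" for v
      using \<open>qvi_dir_derivative X \<xi> emb A \<Phi> f u d \<alpha>\<close> that
      unfolding qvi_dir_derivative_def by (simp flip: F strict_complementarity)
    show "(A \<alpha> - d) (\<alpha> - v) = 0" if v: "v \<in> ?S \<alpha>" for v
    proof -
      \<comment> \<open>The coefficients 2 and -1 add up to 1, so the right-hand side collapses to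
        \<open>?G \<alpha>\<close> and the reflected point stays in the same set.\<close>
      have "qe_on X \<xi> emb ?E (\<lambda>x. qc_rep X \<xi> emb (2 *\<^sub>R \<alpha> + (-1) *\<^sub>R v) x =
          qc_rep X \<xi> emb (2 *\<^sub>R ?G \<alpha> + (-1) *\<^sub>R ?G \<alpha>) x)"
        using \<alpha> v unfolding S_iff by (rule qc_rep_eq_linear[OF E])
      then have "2 *\<^sub>R \<alpha> + (-1) *\<^sub>R v \<in> ?S \<alpha>" unfolding S_iff by (simp add: scaleR_2)
      from le[OF this] have "(A \<alpha> - d) (- (\<alpha> - v)) \<le> 0" by (simp add: scaleR_2)
      then have "(A \<alpha> - d) (\<alpha> - v) \<ge> 0" unfolding blinfun.minus_right by simp
      with le[OF v] show ?thesis by linarith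
    qed
  qed

  \<comment> \<open>Additivity in the direction\<close>
  moreover have "\<alpha> = c1 *\<^sub>R \<alpha>1 + c2 *\<^sub>R \<alpha>2"
    if lin: "\<forall>v. linear (hadamard_deriv F v)"
      and \<alpha>1: "qvi_dir_derivative X \<xi> emb A \<Phi> f u d1 \<alpha>1"
      and \<alpha>2: "qvi_dir_derivative X \<xi> emb A \<Phi> f u d2 \<alpha>2"
      and \<alpha>: "qvi_dir_derivative X \<xi> emb A \<Phi> f u (c1 *\<^sub>R d1 + c2 *\<^sub>R d2) \<alpha>"
    for d1 d2 \<alpha>1 \<alpha>2 \<alpha> and c1 c2 :: real
  proof -
    have G: "?G (a *\<^sub>R v + b *\<^sub>R w) = a *\<^sub>R ?G v + b *\<^sub>R ?G w" for a b v w
      using lin by (simp add: linear_add linear_scale)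
    \<comment> \<open>Linearity of \<open>?G\<close> makes the combination of derivatives the
      derivative at the combination.\<close>
    have S_lin: "a *\<^sub>R \<phi> + b *\<^sub>R \<psi> \<in> ?S (a *\<^sub>R v + b *\<^sub>R w)"
      if "\<phi> \<in> ?S v" "\<psi> \<in> ?S w" for a b \<phi> \<psi> v w
      using that unfolding S_iff G by (rule qc_rep_eq_linear[OF E])
    have self: "?G v \<in> ?S v" for v
      unfolding S_iff qe_on_def by (simp add: cap_eq_0_iff exI[of _ 0] cap_test_empty)
    define \<beta> where "\<beta> = \<alpha> - (c1 *\<^sub>R \<alpha>1 + c2 *\<^sub>R \<alpha>2)"
    \<comment> \<open>Both \<beta> and \<open>?G \<beta>\<close> lie in \<open>?S \<beta>\<close>,
      so their difference lies in \<open>?S 0\<close>, a space of test directions shared by all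
      three problems.\<close>
    define \<sigma> where "\<sigma> = \<beta> - ?G \<beta>"
    have "1 *\<^sub>R \<alpha> + (-1) *\<^sub>R (c1 *\<^sub>R \<alpha>1 + c2 *\<^sub>R \<alpha>2) \<in>
        ?S (1 *\<^sub>R \<alpha> + (-1) *\<^sub>R (c1 *\<^sub>R \<alpha>1 + c2 *\<^sub>R \<alpha>2))"
      by (intro S_lin part1(1)[OF \<alpha>] part1(1)[OF \<alpha>1] part1(1)[OF \<alpha>2])
    moreover have "\<beta> = 1 *\<^sub>R \<alpha> + (-1) *\<^sub>R (c1 *\<^sub>R \<alpha>1 + c2 *\<^sub>R \<alpha>2)"
      by (simp add: \<beta>_def)
    ultimately have "\<beta> \<in> ?S \<beta>" by simp
    then have "1 *\<^sub>R \<beta> + (-1) *\<^sub>R ?G \<beta> \<in> ?S (1 *\<^sub>R \<beta> + (-1) *\<^sub>R \<beta>)"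
      using self by (rule S_lin)
    then have \<sigma>: "\<sigma> \<in> ?S 0" by (simp add: \<sigma>_def)
    have test: "(A y) \<sigma> = d \<sigma>" if y: "qvi_dir_derivative X \<xi> emb A \<Phi> f u d y" for d y
    proof -
      have "1 *\<^sub>R y + (-1) *\<^sub>R \<sigma> \<in> ?S (1 *\<^sub>R y + (-1) *\<^sub>R 0)"
        using part1(1)[OF y] \<sigma> by (rule S_lin)
      then have "y - \<sigma> \<in> ?S y" by simp
      from part1(2)[OF y this] show ?thesis by (simp add: blinfun.diff_left)
    qed
    \<comment> \<open>Tested with \<sigma>, the three right-hand sides cancel: that for \<alpha> is
      the same combination of those for \<open>\<alpha>1\<close> and
      \<open>\<alpha>2\<close>.\<close>
    have "A \<beta> = A \<alpha> - (c1 *\<^sub>R A \<alpha>1 + c2 *\<^sub>R A \<alpha>2)"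
      unfolding \<beta>_def using A_linear by (simp add: linear_diff linear_add linear_scale)
    then have "A \<beta> \<sigma> = 0"
      by (simp add: blinfun.diff_left blinfun.add_left blinfun.scaleR_left test[OF \<alpha>] test[OF \<alpha>1] test[OF \<alpha>2])
    then have eq: "A \<beta> \<beta> = A \<beta> (?G \<beta>)" by (simp add: \<sigma>_def blinfun.diff_right)
    obtain e C where "e > 0" and C: "C < 1 / (1 + inverse Ca * Cb)"
      and bound: "\<forall>z\<in>cball u e. \<forall>v. norm (hadamard_deriv F z v) \<le> C * norm v"
      using A5 unfolding assumption_A5_def by blast
    \<comment> \<open>The bound is taken at the centre \<open>z = u\<close> of the ball.\<close>
    then have G_bound: "norm (?G v) \<le> C * norm v" for v by simp
    have "\<beta> = 0"
    proof (rule ccontr)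
      assume "\<beta> \<noteq> 0"
      then have pos: "norm \<beta> > 0" by simp
      \<comment> \<open>A nonzero vector forces \<open>Ca \<le> Cb\<close>, which supplies the
        positivity of \<open>Cb\<close> needed to multiply inequalities by it.\<close>
      have "Ca * (norm \<beta>)\<^sup>2 \<le> Cb * norm \<beta> * norm \<beta>"
        using A_coercive[of \<beta>] A_bounded[of \<beta> \<beta>] by linarith
      then have "Ca \<le> Cb" using pos by (simp add: power2_eq_square)
      then have Cb: "Cb > 0" using Ca_pos by linarith
      have "Ca * (norm \<beta>)\<^sup>2 \<le> Cb * norm \<beta> * norm (?G \<beta>)"
        using A_coercive[of \<beta>] A_bounded[of \<beta> "?G \<beta>"] eq by linarith
      also have "\<dots> \<le> Cb * norm \<beta> * (C * norm \<beta>)"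
        using Cb pos G_bound by (intro mult_left_mono) auto
      finally have "Ca \<le> Cb * C" using pos by (simp add: power2_eq_square)
      \<comment> \<open>The threshold equals \<open>Ca / (Ca + Cb)\<close>, so
        \<open>C * Ca + C * Cb < Ca\<close>; with \<open>C * Ca > 0\<close> this contradicts
        \<open>Ca \<le> Cb * C\<close>.\<close>
      moreover have "1 / (1 + inverse Ca * Cb) = Ca / (Ca + Cb)"
        using Ca_pos Cb by (simp add: field_simps)
      then have "C * (Ca + Cb) < Ca"
        using C Ca_pos Cb by (simp add: pos_less_divide_eq)
      moreover have "C > 0"
        using \<open>Ca \<le> Cb * C\<close> Ca_pos Cb by (smt (verit) mult_nonneg_nonpos)
      then have "C * Ca > 0" using Ca_pos by simp
      ultimately show False by (simp add: algebra_simps)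
    qed
    then show ?thesis by (simp add: \<beta>_def)
  qed
  ultimately show ?thesis by (intro conjI ballI allI impI)
qed

end
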